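(* For every $N\ge 3$ and every $\mathbb{E}\in\mathbb{R}^N$, \[ \inf_{|\Omega|=|B_1|}\ \mathcal{H}^{N-1}(\partial\Omega)+\mathcal{F}(\Omega)=-\infty . \]
   Context: The infimum runs over compact sets $\Omega\subset\mathbb{R}^N$ with $|\Omega|=|B_1|$, where $B_1$ is the unit ball of $\mathbb{R}^N$, $|\cdot|$ denotes Lebesgue measure and $\mathcal{H}^{N-1}$ is the $(N-1)$-dimensional Hausdorff measure. The vector $\mathbb{E}$ is a constant external electric field. For a signed measure $\mu$, \[ I_2(\mu):=\int_{\mathbb{R}^N\times\mathbb{R}^N}\frac{d\mu(x)\,d\mu(y)}{|x-y|^{N-2}} , \] and \[ \mathcal{F}(\Omega):=\min_{\mu(\Omega)=0}\left( I_2(\mu)-\int_\Omega \mathbb{E}\cdot x\,d\mu(x)\right), \] where the minimization is over signed measures $\mu$ supported on $\Omega$ with $\mu(\Omega)=0$.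
   Formalization: The field 𝔼 is assumed nonzero: for 𝔼 = 0 the claim is false, since I₂ ≥ 0 on neutral charges gives F(Ω) = 0 and the infimum is then nonnegative. *)

theory Defs
  imports "HOL-Analysis.Analysis"
begin

text \<open>
  Hausdorff measure of integer dimension \<open>k\<close>, normalised so that it agrees with Lebesgue measure in
  dimension \<open>k\<close>: a covering set \<open>C\<close> costs \<open>\<omega>\<^sub>k (diam C / 2)^k\<close>. The covering sets are required to be
  bounded because \<^const>\<open>diameter\<close> is meaningless on unbounded sets; the empty set costs \<open>0\<close>
  also for \<open>k = 0\<close>.
\<close>

definition hausdorff_cost :: "nat \<Rightarrow> 'a::metric_space set \<Rightarrow> ennreal" where
  "hausdorff_cost k C =
     (if C = {} then 0 else ennreal (unit_ball_vol (real k) * (diameter C / 2) ^ k))"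

definition hausdorff_premeasure :: "nat \<Rightarrow> real \<Rightarrow> 'a::metric_space set \<Rightarrow> ennreal" where
  "hausdorff_premeasure k \<delta> A =
     (INF C \<in> {C :: nat \<Rightarrow> 'a set. A \<subseteq> (\<Union>i. C i) \<and> (\<forall>i. bounded (C i) \<and> diameter (C i) \<le> \<delta>)}.
        \<Sum>i. hausdorff_cost k (C i))"

definition hausdorff_measure :: "nat \<Rightarrow> 'a::metric_space set \<Rightarrow> ennreal" where
  "hausdorff_measure k A = (SUP \<delta> \<in> {0<..}. hausdorff_premeasure k \<delta> A)"

definition signed_borel_measure :: "('a::topological_space set \<Rightarrow> real) \<Rightarrow> bool" where
  "signed_borel_measure \<mu> \<longleftrightarrow>
     \<mu> {} = 0 \<and>
     (\<forall>A. range A \<subseteq> sets borel \<and> disjoint_family A \<longrightarrow>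
        (\<lambda>i::nat. \<mu> (A i)) sums \<mu> (\<Union>i. A i))"

text \<open>For closed \<open>\<Omega>\<close> this says that the support of \<open>\<mu>\<close> is contained in \<open>\<Omega>\<close>.\<close>

definition supported_on :: "('a::topological_space set \<Rightarrow> real) \<Rightarrow> 'a set \<Rightarrow> bool" where
  "supported_on \<mu> \<Omega> \<longleftrightarrow> (\<forall>A \<in> sets borel. A \<inter> \<Omega> = {} \<longrightarrow> \<mu> A = 0)"

text \<open>
  Jordan decomposition \<open>\<mu> = \<mu>\<^sup>+ - \<mu>\<^sup>-\<close>: \<open>\<mu>\<^sup>+ A\<close> is the supremum of \<open>\<mu>\<close> over the Borel subsets of \<open>A\<close>.
  The supremum is at least \<open>\<mu> {} = 0\<close>, so truncating negative values by \<^const>\<open>ennreal\<close> is harmless.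
\<close>

definition jordan_pos :: "('a::topological_space set \<Rightarrow> real) \<Rightarrow> 'a measure" where
  "jordan_pos \<mu> = measure_of UNIV (sets borel)
     (\<lambda>A. SUP B \<in> {B \<in> sets borel. B \<subseteq> A}. ennreal (\<mu> B))"

definition jordan_neg :: "('a::topological_space set \<Rightarrow> real) \<Rightarrow> 'a measure" where
  "jordan_neg \<mu> = jordan_pos (\<lambda>A. - \<mu> A)"

definition set_integral_signed ::
    "('a::topological_space set \<Rightarrow> real) \<Rightarrow> 'a set \<Rightarrow> ('a \<Rightarrow> real) \<Rightarrow> real" where
  "set_integral_signed \<mu> \<Omega> f =
     (LINT x:\<Omega>|jordan_pos \<mu>. f x) - (LINT x:\<Omega>|jordan_neg \<mu>. f x)"

text \<open>
  The kernel \<open>1 / |x - y|^(N-2)\<close>. The division is that of \<^typ>\<open>ennreal\<close>, so for \<open>N \<ge> 3\<close> the kernel is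
  \<open>\<infinity>\<close> on the diagonal (and point charges have infinite self-energy); real division would give \<open>0\<close>.
\<close>

definition riesz_kernel :: "'a::euclidean_space \<Rightarrow> 'a \<Rightarrow> ennreal" where
  "riesz_kernel x y = 1 / ennreal (norm (x - y) ^ (DIM('a) - 2))"

definition mutual_energy ::
    "'a::euclidean_space measure \<Rightarrow> 'a measure \<Rightarrow> ennreal" where
  "mutual_energy \<mu> \<nu> = (\<integral>\<^sup>+ z. riesz_kernel (fst z) (snd z) \<partial>(\<mu> \<Otimes>\<^sub>M \<nu>))"

text \<open>
  The energy \<open>I\<^sub>2\<close> of a signed measure: the integral of the nonnegative kernel against the positive part
  of the signed measure \<open>\<mu> \<otimes> \<mu>\<close> minus that against its negative part. Since \<open>\<infinity> - \<infinity> = \<infinity>\<close> in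
  \<^typ>\<open>ereal\<close>, signed measures for which the double integral is undefined get energy \<open>\<infinity>\<close>, that is,
  they do not compete in the minimisation below.
\<close>

definition I2 :: "('a::euclidean_space set \<Rightarrow> real) \<Rightarrow> ereal" where
  "I2 \<mu> =
     enn2ereal (mutual_energy (jordan_pos \<mu>) (jordan_pos \<mu>)
              + mutual_energy (jordan_neg \<mu>) (jordan_neg \<mu>))
   - enn2ereal (mutual_energy (jordan_pos \<mu>) (jordan_neg \<mu>)
              + mutual_energy (jordan_neg \<mu>) (jordan_pos \<mu>))"

definition neutral_charges :: "'a::euclidean_space set \<Rightarrow> ('a set \<Rightarrow> real) set" where
  "neutral_charges \<Omega> = {\<mu>. signed_borel_measure \<mu> \<and> supported_on \<mu> \<Omega> \<and> \<mu> \<Omega> = 0}"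

text \<open>
  The minimum is taken as an infimum in the extended reals, which is its value whenever it is attained.
\<close>

definition field_energy :: "'a::euclidean_space \<Rightarrow> 'a set \<Rightarrow> ereal" where
  "field_energy E \<Omega> =
     (INF \<mu> \<in> neutral_charges \<Omega>.
        I2 \<mu> - ereal (set_integral_signed \<mu> \<Omega> (\<lambda>x. E \<bullet> x)))"

end

theory Submission
  imports Defs
begin

text \<open>
  The competitors need not be connected. Take two fixed cubes of total volume \<open>|B\<^sub>1|\<close>, one translated
  by a long vector \<open>t E\<close>, and charge them uniformly with opposite signs. The perimeter and the two
  self-energies do not depend on \<open>t\<close>, the mutual interaction only lowers \<open>I\<^sub>2\<close>, and the field term
  tends to \<open>-\<infinity>\<close> linearly in \<open>t\<close>.
\<close>

subsection \<open>Hausdorff measure of the boundary of a cube\<close>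

text \<open>A finite family of balls becomes a countable cover when padded with empty sets. These
  cost 0 even for \<open>k = 0\<close>, so the series stops after \<open>card P\<close> terms, each
  equal to the cost of a ball of diameter \<open>2 * r\<close>.\<close>

lemma hausdorff_premeasure_le_balls:
  fixes A P :: "'a::euclidean_space set"
  assumes "finite P" "A \<subseteq> (\<Union>p\<in>P. cball p r)" "0 \<le> r" "2 * r \<le> \<delta>"
  shows "hausdorff_premeasure k \<delta> A \<le> ennreal (real (card P) * (unit_ball_vol (real k) * r ^ k))"
proof -
  obtain e where e: "bij_betw e {0..<card P} P"
    using ex_bij_betw_nat_finite[OF assms(1)] by blast
  define C where "C = (\<lambda>i. if i < card P then cball (e i) r else {})"
  have im: "P = e ` {0..<card P}" using e by (simp add: bij_betw_def)
  have "A \<subseteq> (\<Union>i. C i)"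
  proof
    fix x assume "x \<in> A"
    then obtain p where "p \<in> P" "x \<in> cball p r" using assms(2) by blast
    moreover from \<open>p \<in> P\<close> obtain i where "i < card P" "p = e i" using im by force
    ultimately show "x \<in> (\<Union>i. C i)" by (auto simp: C_def intro!: exI[of _ i])
  qed
  moreover have "\<forall>i. bounded (C i) \<and> diameter (C i) \<le> \<delta>"
    using assms(3,4) by (auto simp: C_def)
  ultimately have "hausdorff_premeasure k \<delta> A \<le> (\<Sum>i. hausdorff_cost k (C i))"
    unfolding hausdorff_premeasure_def by (intro INF_lower) auto
  also have "\<dots> = (\<Sum>i<card P. hausdorff_cost k (C i))"
    by (intro suminf_finite) (auto simp: C_def hausdorff_cost_def)
  also have "\<dots> = (\<Sum>i<card P. ennreal (unit_ball_vol (real k) * r ^ k))"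
    using assms(3) by (intro sum.cong) (auto simp: C_def hausdorff_cost_def)
  also have "\<dots> = ennreal (real (card P) * (unit_ball_vol (real k) * r ^ k))"
    using assms(3) by (simp add: ennreal_mult'' ennreal_of_nat_eq_real_of_nat)
  finally show ?thesis .
qed

text \<open>If the number of balls grows like \<open>m ^ k\<close> while the radius shrinks like
  \<open>1 / m\<close>, the powers of \<open>m\<close> cancel in the total cost. The bound is
  therefore uniform in the scale and survives the supremum over \<open>\<delta>\<close>.\<close>

lemma hausdorff_measure_le_balls:
  fixes A :: "'a::euclidean_space set"
  assumes "0 \<le> c"
    and cover: "\<And>m::nat. m > 0 \<Longrightarrow>
      \<exists>P. finite P \<and> real (card P) \<le> K * real m ^ k \<and> A \<subseteq> (\<Union>p\<in>P. cball p (c / real m))"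
  shows "hausdorff_measure k A \<le> ennreal (K * (unit_ball_vol (real k) * c ^ k))"
  unfolding hausdorff_measure_def
proof (rule SUP_least)
  fix \<delta> :: real assume "\<delta> \<in> {0<..}"
  hence \<delta>: "\<delta> > 0" by simp
  \<comment> \<open>Fine enough that balls of radius \<open>c / m\<close> have diameter at most
    \<open>\<delta>\<close>.\<close>
  obtain m :: nat where m: "2 * c / \<delta> < real m" using reals_Archimedean2 by blast
  have m0: "m > 0" using m assms(1) \<delta> by (cases m) (auto simp: field_simps)
  obtain P where P: "finite P" "real (card P) \<le> K * real m ^ k" "A \<subseteq> (\<Union>p\<in>P. cball p (c / real m))"
    using cover[OF m0] by blast
  have "2 * (c / real m) \<le> \<delta>" using m m0 \<delta> by (simp add: field_simps)
  hence "hausdorff_premeasure k \<delta> A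
      \<le> ennreal (real (card P) * (unit_ball_vol (real k) * (c / real m) ^ k))"
    using P assms(1) by (intro hausdorff_premeasure_le_balls) auto
  also have "\<dots> \<le> ennreal ((K * real m ^ k) * (unit_ball_vol (real k) * (c / real m) ^ k))"
    using P assms(1) by (intro ennreal_leI mult_right_mono) auto
  also have "(K * real m ^ k) * (unit_ball_vol (real k) * (c / real m) ^ k)
      = K * (unit_ball_vol (real k) * c ^ k)"
    using m0 by (simp add: power_divide)
  finally show "hausdorff_premeasure k \<delta> A \<le> ennreal (K * (unit_ball_vol (real k) * c ^ k))" .
qed

section \<open>Grid covers of the boundary of a cube\<close>

lemma dist_le_cart:
  fixes x y :: "real ^ 'n"
  assumes "\<And>j. \<bar>x $ j - y $ j\<bar> \<le> d"
  shows "dist x y \<le> real CARD('n) * d"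
proof -
  have "dist x y \<le> (\<Sum>j\<in>UNIV. \<bar>(x - y) $ j\<bar>)" unfolding dist_norm by (rule norm_le_l1_cart)
  also have "\<dots> \<le> (\<Sum>j\<in>(UNIV::'n set). d)" using assms by (intro sum_mono) auto
  finally show ?thesis by simp
qed

lemma dist_le_cube:
  fixes a x y :: "real ^ 'n"
  assumes "x \<in> cbox a (a + (\<chi> i. s))" "y \<in> cbox a (a + (\<chi> i. s))"
  shows "dist x y \<le> real CARD('n) * s"
proof (rule dist_le_cart)
  fix j
  have "a $ j \<le> x $ j" "x $ j \<le> a $ j + s" "a $ j \<le> y $ j" "y $ j \<le> a $ j + s"
    using assms by (auto simp: mem_box_cart)
  thus "\<bar>x $ j - y $ j\<bar> \<le> s" by linarith
qed

text \<open>The centres form a grid of mesh \<open>s / m\<close> on the \<open>2 * CARD('n)\<close>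
  faces. A face carries \<open>(m + 1) ^ (CARD('n) - 1)\<close> grid points, and rounding moves a
  boundary point by at most one mesh width in each coordinate.\<close>

lemma frontier_cube_ball_cover:
  fixes a :: "real ^ 'n"
  assumes s: "0 < s" and m: "m > (0::nat)"
  shows "\<exists>P. finite P
    \<and> real (card P) \<le> (2 * real CARD('n) * 2 ^ (CARD('n) - 1)) * real m ^ (CARD('n) - 1)
    \<and> frontier (cbox a (a + (\<chi> i. s))) \<subseteq> (\<Union>p\<in>P. cball p (real CARD('n) * s / real m))"
proof -
  \<comment> \<open>A triple \<open>(i, e, g)\<close> selects the face on which coordinate
    \<open>i\<close> has offset \<open>e\<close> from \<open>a\<close>, and a grid point
    \<open>g\<close> for the remaining coordinates. Both ends of the edge are included, hence
    \<open>Suc m\<close> values per coordinate.\<close>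
  define I where "I = (SIGMA i:(UNIV::'n set). {0, s} \<times> ((UNIV - {i}) \<rightarrow>\<^sub>E {..m}))"
  define F :: "'n \<times> real \<times> ('n \<Rightarrow> nat) \<Rightarrow> real ^ 'n" where
    "F = (\<lambda>(i, e, g). \<chi> j. a $ j + (if j = i then e else real (g j) * s / real m))"
  have fin: "finite I" unfolding I_def by (intro finite_SigmaI finite_PiE) (auto intro!: finite_PiE)
  have "card I = CARD('n) * (2 * Suc m ^ (CARD('n) - 1))"
    unfolding I_def using s
    by (subst card_SigmaI) (auto simp: card_cartesian_product card_PiE card_Diff_singleton intro!: finite_PiE)
  hence "real (card I) = 2 * real CARD('n) * real (Suc m) ^ (CARD('n) - 1)"
    by simp
  \<comment> \<open>Since \<open>m > 0\<close>, \<open>Suc m \<le> 2 * m\<close>; this turns the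
    count into a pure power of \<open>m\<close>.\<close>
  also have "\<dots> \<le> 2 * real CARD('n) * (2 * real m) ^ (CARD('n) - 1)"
    using m by (intro mult_left_mono power_mono) auto
  finally have "real (card I) \<le> (2 * real CARD('n) * 2 ^ (CARD('n) - 1)) * real m ^ (CARD('n) - 1)"
    by (simp add: power_mult_distrib mult_ac)
  moreover have "card (F ` I) \<le> card I" using fin by (rule card_image_le)
  ultimately have card: "real (card (F ` I))
      \<le> (2 * real CARD('n) * 2 ^ (CARD('n) - 1)) * real m ^ (CARD('n) - 1)"
    by linarith
  have "x \<in> (\<Union>p\<in>F ` I. cball p (real CARD('n) * s / real m))"
    if x: "x \<in> frontier (cbox a (a + (\<chi> i. s)))" for x
  proof -
    have b: "a $ j \<le> x $ j" "x $ j \<le> a $ j + s" for j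
      using x by (auto simp: frontier_cbox mem_box_cart)
    obtain i where i: "\<not> (a $ i < x $ i \<and> x $ i < a $ i + s)"
      using x by (auto simp: frontier_cbox mem_box_cart)
    \<comment> \<open>Every free coordinate is rounded down to the grid; \<open>restrict\<close>
      puts the result into the extensional function space that indexes \<open>I\<close>.\<close>
    define g where "g = restrict (\<lambda>j. nat \<lfloor>(x $ j - a $ j) * real m / s\<rfloor>) (UNIV - {i})"
    have q: "0 \<le> (x $ j - a $ j) * real m / s" "(x $ j - a $ j) * real m / s \<le> real m" for j
    proof -
      show "0 \<le> (x $ j - a $ j) * real m / s" using b[of j] s by simp
      have "(x $ j - a $ j) * real m \<le> s * real m"
        using b[of j] by (intro mult_right_mono) auto
      thus "(x $ j - a $ j) * real m / s \<le> real m" using s by (simp add: pos_divide_le_eq mult.commute)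
    qed
    have "nat \<lfloor>(x $ j - a $ j) * real m / s\<rfloor> \<le> m" for j
      using q[of j] by (simp add: nat_le_iff floor_le_iff)
    hence g: "g \<in> (UNIV - {i}) \<rightarrow>\<^sub>E {..m}" by (auto simp: g_def)
    have "x $ i - a $ i \<in> {0, s}" using i b[of i] by force
    hence p: "(i, x $ i - a $ i, g) \<in> I"
      unfolding I_def using g by (intro SigmaI UNIV_I)
    have "dist (F (i, x $ i - a $ i, g)) x \<le> real CARD('n) * (s / real m)"
    proof (rule dist_le_cart)
      fix j
      show "\<bar>F (i, x $ i - a $ i, g) $ j - x $ j\<bar> \<le> s / real m"
      proof (cases "j = i")
        case True
        thus ?thesis using s by (simp add: F_def)
      next
        case False
        define u where "u = (x $ j - a $ j) * real m / s"
        have gj: "real (g j) = of_int \<lfloor>u\<rfloor>" using q[of j] False by (simp add: g_def u_def)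
        have "\<bar>of_int \<lfloor>u\<rfloor> - u\<bar> \<le> 1" by linarith
        hence "\<bar>of_int \<lfloor>u\<rfloor> - u\<bar> * (s / real m) \<le> 1 * (s / real m)"
          using s by (intro mult_right_mono) auto
        moreover have "F (i, x $ i - a $ i, g) $ j - x $ j = (of_int \<lfloor>u\<rfloor> - u) * (s / real m)"
          using False gj s m by (simp add: F_def u_def field_simps)
        ultimately show ?thesis using s by (simp add: abs_mult)
      qed
    qed
    thus ?thesis using p by (intro UN_I[of "F (i, x $ i - a $ i, g)"]) auto
  qed
  thus ?thesis using card fin by (intro exI[of _ "F ` I"]) auto
qed

text \<open>The frontier of a union lies in the union of the frontiers, so the two covers can be
  joined. The point is that the bound involves neither \<open>a\<close> nor \<open>b\<close>: moving
  the cubes apart leaves it unchanged.\<close>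

lemma hausdorff_measure_two_cubes:
  fixes a b :: "real ^ 'n"
  assumes s: "0 < s"
  shows "hausdorff_measure (CARD('n) - 1)
      (frontier (cbox a (a + (\<chi> i. s)) \<union> cbox b (b + (\<chi> i. s))))
    \<le> ennreal ((4 * real CARD('n) * 2 ^ (CARD('n) - 1)) *
        (unit_ball_vol (real (CARD('n) - 1)) * (real CARD('n) * s) ^ (CARD('n) - 1)))"
proof (rule hausdorff_measure_le_balls)
  fix m :: nat assume m: "m > 0"
  let ?K = "(2 * real CARD('n) * 2 ^ (CARD('n) - 1)) * real m ^ (CARD('n) - 1)"
  obtain P where P: "finite P" "real (card P) \<le> ?K"
      "frontier (cbox a (a + (\<chi> i. s))) \<subseteq> (\<Union>p\<in>P. cball p (real CARD('n) * s / real m))"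
    using frontier_cube_ball_cover[OF s m, of a] by blast
  obtain Q where Q: "finite Q" "real (card Q) \<le> ?K"
      "frontier (cbox b (b + (\<chi> i. s))) \<subseteq> (\<Union>p\<in>Q. cball p (real CARD('n) * s / real m))"
    using frontier_cube_ball_cover[OF s m, of b] by blast
  have "real (card (P \<union> Q)) \<le> real (card P) + real (card Q)"
    using card_Un_le[of P Q] by linarith
  also have "\<dots> \<le> (4 * real CARD('n) * 2 ^ (CARD('n) - 1)) * real m ^ (CARD('n) - 1)"
    using P(2) Q(2) by (simp add: algebra_simps)
  finally show "\<exists>P. finite P \<and>
      real (card P) \<le> (4 * real CARD('n) * 2 ^ (CARD('n) - 1)) * real m ^ (CARD('n) - 1) \<and>
      frontier (cbox a (a + (\<chi> i. s)) \<union> cbox b (b + (\<chi> i. s)))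
        \<subseteq> (\<Union>p\<in>P. cball p (real CARD('n) * s / real m))"
    using P Q frontier_Un_subset[of "cbox a (a + (\<chi> i. s))" "cbox b (b + (\<chi> i. s))"]
    by (intro exI[of _ "P \<union> Q"]) blast
qed (use s in simp)

subsection \<open>Signed measures\<close>

lemma signed_borel_measure_diff:
  assumes "finite_measure P" "finite_measure Q" "sets P = sets borel" "sets Q = sets borel"
  shows "signed_borel_measure (\<lambda>A. measure P A - measure Q A)"
  unfolding signed_borel_measure_def using assms
  by (auto intro!: sums_diff finite_measure.finite_measure_UNION)

text \<open>\<open>S\<close> is a Hahn set: \<open>P\<close> is carried by \<open>S\<close> and
  \<open>Q\<close> by its complement. Hence the supremum over Borel subsets of \<open>A\<close> is
  attained at \<open>A \<inter> S\<close>, where its value is the \<open>P\<close>-measure of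
  \<open>A\<close>.\<close>

lemma jordan_pos_diff:
  fixes P Q :: "'a::topological_space measure"
  assumes P: "finite_measure P" "sets P = sets borel"
    and Q: "finite_measure Q" "sets Q = sets borel"
    and S: "S \<in> sets borel" "emeasure P (- S) = 0" "emeasure Q S = 0"
  shows "jordan_pos (\<lambda>A. measure P A - measure Q A) = P"
proof -
  interpret P: finite_measure P by fact
  interpret Q: finite_measure Q by fact
  have sp: "space P = UNIV" using sets_eq_imp_space_eq[OF P(2)] by simp
  have "(SUP B \<in> {B \<in> sets borel. B \<subseteq> A}. ennreal (measure P B - measure Q B)) = emeasure P A"
    if A: "A \<in> sets borel" for A
  proof (rule antisym)
    show "(SUP B \<in> {B \<in> sets borel. B \<subseteq> A}. ennreal (measure P B - measure Q B)) \<le> emeasure P A"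
    proof (rule SUP_least)
      fix B assume "B \<in> {B \<in> sets borel. B \<subseteq> A}"
      hence "measure P B \<le> measure P A" using A P by (intro P.finite_measure_mono) auto
      hence "measure P B - measure Q B \<le> measure P A"
        by (smt (verit) measure_nonneg)
      thus "ennreal (measure P B - measure Q B) \<le> emeasure P A"
        by (simp add: P.emeasure_eq_measure ennreal_leI)
    qed
    have "emeasure P A = emeasure P (A \<inter> S) + emeasure P (A - S)"
      using A S P by (subst plus_emeasure) (auto intro!: arg_cong[where f="emeasure P"])
    moreover have "emeasure P (A - S) = 0"
      using emeasure_mono[of "A - S" "- S" P] S(1,2) P by auto
    moreover have "measure Q (A \<inter> S) = 0"
      using emeasure_mono[of "A \<inter> S" S Q] S(1,3) Q by (auto simp: measure_def)
    ultimately have "emeasure P A = ennreal (measure P (A \<inter> S) - measure Q (A \<inter> S))"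
      by (simp add: P.emeasure_eq_measure)
    also have "\<dots> \<le> (SUP B \<in> {B \<in> sets borel. B \<subseteq> A}. ennreal (measure P B - measure Q B))"
      using A S by (intro SUP_upper) auto
    finally show "emeasure P A \<le> (SUP B \<in> {B \<in> sets borel. B \<subseteq> A}. ennreal (measure P B - measure Q B))" .
  qed
  \<comment> \<open>\<open>measure_of\<close> depends only on the values on the sigma-algebra, so
    the set function just computed can be replaced by \<open>emeasure P\<close>.\<close>
  hence "jordan_pos (\<lambda>A. measure P A - measure Q A) = measure_of UNIV (sets borel) (emeasure P)"
    unfolding jordan_pos_def
    by (intro measure_of_eq) (auto simp: sets.sigma_sets_eq[of borel, simplified])
  also have "\<dots> = P" using measure_of_of_measure[of P] sp P by simp
  finally show ?thesis .
qed

text \<open>Exchanging \<open>P\<close> and \<open>Q\<close> changes the sign of the charge and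
  replaces the Hahn set by its complement.\<close>

lemma jordan_neg_diff:
  fixes P Q :: "'a::topological_space measure"
  assumes "finite_measure P" "sets P = sets borel" "finite_measure Q" "sets Q = sets borel"
    and "S \<in> sets borel" "emeasure P (- S) = 0" "emeasure Q S = 0"
  shows "jordan_neg (\<lambda>A. measure P A - measure Q A) = Q"
proof -
  have "jordan_pos (\<lambda>A. measure Q A - measure P A) = Q"
    using assms by (intro jordan_pos_diff[where S="- S"]) auto
  thus ?thesis by (simp add: jordan_neg_def)
qed

text \<open>The cross terms are nonnegative and enter with a minus sign, so the interaction of the
  opposite charges never has to be estimated.\<close>

lemma I2_le_self_energies:
  "I2 \<mu> \<le> enn2ereal (mutual_energy (jordan_pos \<mu>) (jordan_pos \<mu>)
                 + mutual_energy (jordan_neg \<mu>) (jordan_neg \<mu>))"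
  unfolding I2_def by (rule ereal_diff_le_self) simp

subsection \<open>Self-energy of a uniform charge\<close>

text \<open>Dyadic decomposition around \<open>x\<close>. With \<open>N = DIM('a)\<close>, the
  kernel on the shell of outer radius \<open>R / 2 ^ k\<close> is at most its value at half that
  radius, of order \<open>(2 ^ k / R) ^ (N - 2)\<close>, and the enclosing ball has volume of order
  \<open>(R / 2 ^ k) ^ N\<close>. The products are of order \<open>R\<^sup>2 / 4 ^ k\<close> and
  form a geometric series.\<close>

lemma riesz_potential_le:
  fixes x :: "'a::euclidean_space"
  assumes dim: "DIM('a) \<ge> 2" and R: "0 < R" and S: "S \<in> sets borel" "S \<subseteq> cball x R"
  shows "(\<integral>\<^sup>+ y\<in>S. riesz_kernel x y \<partial>lborel)
    \<le> ennreal (2 ^ DIM('a) * unit_ball_vol (real DIM('a)) * R\<^sup>2)"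
proof -
  define n where "n = DIM('a) - 2"
  have N: "DIM('a) = n + 2" using dim by (simp add: n_def)
  define c where "c = (\<lambda>k::nat. (2 ^ Suc k / R) ^ n)"
  \<comment> \<open>The point \<open>y = x\<close>, where the kernel may be infinite, is left out;
    it is a Lebesgue null set.\<close>
  have ptw: "riesz_kernel x y * indicator S y
      \<le> (\<Sum>k. ennreal (c k) * indicator (cball x (R / 2 ^ k)) y)" if "y \<noteq> x" for y
  proof (cases "y \<in> S")
    case True
    define d where "d = norm (x - y)"
    have d: "0 < d" "d \<le> R" using that True S(2) by (auto simp: d_def dist_norm)
    \<comment> \<open>The dyadic shell around \<open>x\<close> that contains \<open>y\<close>.\<close>
    obtain k where k: "d \<le> R / 2 ^ k" "R / 2 ^ Suc k < d"
    proof -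
      obtain j :: nat where j: "(1/2) ^ j < d / R"
        using real_arch_pow_inv[of "d / R" "1/2"] d R by auto
      define l where "l = (LEAST j. R / 2 ^ j < d)"
      have ex: "R / 2 ^ j < d" using j R by (simp add: field_simps power_one_over)
      have l: "R / 2 ^ l < d" unfolding l_def using ex by (rule LeastI)
      \<comment> \<open>Index 0 does not qualify because \<open>d \<le> R\<close>, so the least
        index has a predecessor, which names the shell.\<close>
      have "l \<noteq> 0" using l d by (cases l) auto
      then obtain k where lk: "l = Suc k" using not0_implies_Suc by blast
      have "\<not> R / 2 ^ k < d" using not_less_Least[of k "\<lambda>j. R / 2 ^ j < d"] lk by (simp add: l_def)
      thus ?thesis using l lk that[of k] by simp
    qed
    have "riesz_kernel x y = ennreal (1 / d ^ n)"
      unfolding riesz_kernel_def using d by (subst divide_ennreal[symmetric]) (auto simp: d_def n_def)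
    also have "\<dots> \<le> ennreal (c k)"
    proof (rule ennreal_leI)
      have "1 / d \<le> 2 ^ Suc k / R" using k(2) d R by (simp add: field_simps)
      hence "(1 / d) ^ n \<le> c k" unfolding c_def using d by (intro power_mono) auto
      thus "1 / d ^ n \<le> c k" by (simp add: power_one_over)
    qed
    also have "\<dots> = ennreal (c k) * indicator (cball x (R / 2 ^ k)) y"
      using k(1) by (simp add: d_def dist_norm)
    \<comment> \<open>Full balls may replace disjoint shells: a single term of the series already
      dominates the kernel.\<close>
    also have "\<dots> \<le> (\<Sum>k. ennreal (c k) * indicator (cball x (R / 2 ^ k)) y)"
      using sum_le_suminf[of "\<lambda>k. ennreal (c k) * indicator (cball x (R / 2 ^ k)) y" "{k}"]
      by (simp del: sum_mult_indicator)
    finally show ?thesis using True by simp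
  qed simp
  have shell: "ennreal (c k) * emeasure lborel (cball x (R / 2 ^ k))
      = ennreal (2 ^ n * unit_ball_vol (real DIM('a)) * R\<^sup>2 * (1/4) ^ k)" for k
  proof -
    have "c k * (unit_ball_vol (real DIM('a)) * (R / 2 ^ k) ^ DIM('a))
        = 2 ^ n * unit_ball_vol (real DIM('a)) * R\<^sup>2 * (1/4) ^ k"
    proof -
      \<comment> \<open>Of the \<open>n + 2\<close> factors \<open>R / 2 ^ k\<close>,
        \<open>n\<close> cancel against \<open>c k\<close> up to \<open>2 ^ n\<close>, and the
        remaining two produce the decay \<open>(1/4) ^ k\<close>.\<close>
      have p: "(2::real) ^ Suc k / R * (R / 2 ^ k) = 2" using R by simp
      have q: "(4::real) ^ k = (2 ^ k)\<^sup>2" using power_mult_distrib[of "2::real" 2 k] by (simp add: power2_eq_square)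
      have "c k * (R / 2 ^ k) ^ DIM('a)
          = (2 ^ Suc k / R * (R / 2 ^ k)) ^ n * (R / 2 ^ k)\<^sup>2"
        unfolding c_def N power_add power_mult_distrib by (simp only: mult.assoc)
      also have "\<dots> = 2 ^ n * R\<^sup>2 * (1/4) ^ k"
        unfolding p by (simp add: q power_divide)
      finally show ?thesis by (metis mult.assoc mult.left_commute)
    qed
    thus ?thesis using R
      by (subst emeasure_cball) (auto simp: ennreal_mult'[symmetric] c_def)
  qed
  have "(\<integral>\<^sup>+ y\<in>S. riesz_kernel x y \<partial>lborel)
      \<le> (\<integral>\<^sup>+ y. (\<Sum>k. ennreal (c k) * indicator (cball x (R / 2 ^ k)) y) \<partial>lborel)"
    using AE_lborel_singleton[of x] ptw by (intro nn_integral_mono_AE) auto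
  also have "\<dots> = (\<Sum>k. \<integral>\<^sup>+ y. ennreal (c k) * indicator (cball x (R / 2 ^ k)) y \<partial>lborel)"
    by (intro nn_integral_suminf borel_measurable_times_ennreal borel_measurable_indicator) auto
  also have "\<dots> = (\<Sum>k. ennreal (2 ^ n * unit_ball_vol (real DIM('a)) * R\<^sup>2 * (1/4) ^ k))"
    by (simp add: nn_integral_cmult_indicator borel_closed shell)
  also have "\<dots> = ennreal (\<Sum>k. 2 ^ n * unit_ball_vol (real DIM('a)) * R\<^sup>2 * (1/4) ^ k)"
    by (intro suminf_ennreal2) (auto intro!: summable_mult summable_geometric)
  also have "\<dots> = ennreal (2 ^ n * unit_ball_vol (real DIM('a)) * R\<^sup>2 * (4 / 3))"
    by (subst suminf_mult) (auto simp: suminf_geometric intro!: summable_geometric)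
  \<comment> \<open>The sum \<open>4 / 3\<close> of the geometric series is rounded up to
    \<open>4\<close>, which completes \<open>2 ^ n\<close> to \<open>2 ^ DIM('a)\<close>.\<close>
  also have "\<dots> \<le> ennreal (2 ^ DIM('a) * unit_ball_vol (real DIM('a)) * R\<^sup>2)"
  proof (rule ennreal_leI)
    have "2 ^ n * unit_ball_vol (real DIM('a)) * R\<^sup>2 * (4 / 3)
        \<le> 2 ^ n * unit_ball_vol (real DIM('a)) * R\<^sup>2 * 4"
      by (intro mult_left_mono) auto
    thus "2 ^ n * unit_ball_vol (real DIM('a)) * R\<^sup>2 * (4 / 3)
        \<le> 2 ^ DIM('a) * unit_ball_vol (real DIM('a)) * R\<^sup>2"
      by (simp add: N power_add mult_ac)
  qed
  finally show ?thesis .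
qed

lemma riesz_kernel_measurable [measurable]:
  "(\<lambda>z. riesz_kernel (fst z) (snd z :: 'a::euclidean_space)) \<in> borel_measurable (borel \<Otimes>\<^sub>M borel)"
  unfolding riesz_kernel_def by measurable

text \<open>By Tonelli the energy is the potential of the uniform charge integrated against that
  charge. The potential is uniformly bounded on \<open>S\<close>, since \<open>S\<close> lies in the
  ball of radius \<open>R\<close> around each of its points, and the total charge is the volume of
  \<open>S\<close>.\<close>

lemma self_energy_le:
  fixes S :: "'a::euclidean_space set"
  assumes dim: "DIM('a) \<ge> 2" and R: "0 < R" and S: "S \<in> sets borel"
    and diam: "\<And>x y. x \<in> S \<Longrightarrow> y \<in> S \<Longrightarrow> dist x y \<le> R"
  shows "mutual_energy (density lborel (indicator S)) (density lborel (indicator S))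
    \<le> ennreal (2 ^ DIM('a) * unit_ball_vol (real DIM('a)) * R\<^sup>2) * emeasure lborel S"
proof -
  let ?M = "density lborel (indicator S :: 'a \<Rightarrow> ennreal)"
  let ?C = "ennreal (2 ^ DIM('a) * unit_ball_vol (real DIM('a)) * R\<^sup>2)"
  have [measurable]: "S \<in> sets borel" by fact
  interpret M: sigma_finite_measure ?M
    by (intro sigma_finite_measure.sigma_finite_iff_density_finite[THEN iffD2]
        lborel.sigma_finite_measure_axioms AE_I2) (auto simp: indicator_def)
  have "sets (?M \<Otimes>\<^sub>M ?M) = sets (borel \<Otimes>\<^sub>M borel)" by (intro sets_pair_measure_cong) auto
  hence meas: "(\<lambda>z. riesz_kernel (fst z) (snd z :: 'a)) \<in> borel_measurable (?M \<Otimes>\<^sub>M ?M)"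
    using riesz_kernel_measurable measurable_cong_sets by blast
  have meas_x: "(\<lambda>y. riesz_kernel x y) \<in> borel_measurable borel" for x :: 'a
    unfolding riesz_kernel_def by measurable
  have "mutual_energy ?M ?M = (\<integral>\<^sup>+ x. \<integral>\<^sup>+ y. riesz_kernel x y \<partial>?M \<partial>?M)"
    unfolding mutual_energy_def using M.nn_integral_fst[OF meas] by simp
  also have "\<dots> = (\<integral>\<^sup>+ x. (\<integral>\<^sup>+ y\<in>S. riesz_kernel x y \<partial>lborel) \<partial>?M)"
    using meas_x by (simp add: nn_integral_density mult.commute)
  also have "\<dots> \<le> (\<integral>\<^sup>+ x. ?C \<partial>?M)"
  proof (rule nn_integral_mono_AE)
    \<comment> \<open>The potential bound is available only for centres in \<open>S\<close>; the
      measure \<open>?M\<close> does not see other points.\<close>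
    have "AE x in ?M. x \<in> S" by (subst AE_density) (auto simp: indicator_eq_0_iff split: split_indicator)
    thus "AE x in ?M. (\<integral>\<^sup>+ y\<in>S. riesz_kernel x y \<partial>lborel) \<le> ?C"
    proof eventually_elim
      case (elim x)
      thus ?case using diam by (intro riesz_potential_le dim R S) auto
    qed
  qed
  also have "\<dots> = ?C * emeasure lborel S"
    by (simp add: emeasure_density)
  finally show ?thesis .
qed

subsection \<open>Two uniformly charged sets in an external field\<close>

text \<open>The test charge has density \<open>1\<close> on \<open>S\<close> and \<open>-1\<close>
  on \<open>T\<close>. Equal volumes make it neutral, each self-energy is bounded through
  \<open>R\<close> and \<open>w\<close> alone, and the field contributes at least
  \<open>w * (p - q)\<close>, which is subtracted.\<close>

lemma field_energy_two_sets_le: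
  fixes S T :: "'a::euclidean_space set"
  assumes dim: "DIM('a) \<ge> 2" and R: "0 < R"
    and S: "compact S" "\<And>x y. x \<in> S \<Longrightarrow> y \<in> S \<Longrightarrow> dist x y \<le> R"
    and T: "compact T" "\<And>x y. x \<in> T \<Longrightarrow> y \<in> T \<Longrightarrow> dist x y \<le> R"
    and disj: "S \<inter> T = {}"
    and vol: "measure lborel S = w" "measure lborel T = w"
    and bS: "\<And>x. x \<in> S \<Longrightarrow> p \<le> E \<bullet> x" and bT: "\<And>x. x \<in> T \<Longrightarrow> E \<bullet> x \<le> q"
  shows "field_energy E (S \<union> T)
    \<le> ereal (2 * (2 ^ DIM('a) * unit_ball_vol (real DIM('a)) * R\<^sup>2 * w) - w * (p - q))"
proof -
  define P where "P = density lborel (indicator S :: 'a \<Rightarrow> ennreal)"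
  define Q where "Q = density lborel (indicator T :: 'a \<Rightarrow> ennreal)"
  define C where "C = 2 ^ DIM('a) * unit_ball_vol (real DIM('a)) * R\<^sup>2"
  define \<mu> where "\<mu> = (\<lambda>A. measure P A - measure Q A)"
  have [measurable]: "S \<in> sets borel" "T \<in> sets borel" using S T by (auto intro: borel_compact)
  have emS: "emeasure lborel S = ennreal w" and emT: "emeasure lborel T = ennreal w"
    using emeasure_compact_finite[OF S(1)] emeasure_compact_finite[OF T(1)] vol
    by (auto simp: emeasure_eq_ennreal_measure less_top)
  have w: "0 \<le> w" using vol(1) by (metis measure_nonneg)
  have emP: "emeasure P A = emeasure lborel (A \<inter> S)" and emQ: "emeasure Q A = emeasure lborel (A \<inter> T)"
    if "A \<in> sets borel" for A
    using that by (auto simp: P_def Q_def emeasure_density indicator_inter_arith[symmetric]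
        mult.commute Int_commute)
  have [simp]: "sets P = sets borel" "sets Q = sets borel" by (auto simp: P_def Q_def)
  have [simp]: "space P = UNIV" "space Q = UNIV" by (auto simp: P_def Q_def)
  have fin: "finite_measure P" "finite_measure Q"
    by (auto intro!: finite_measureI simp: emP emQ emS emT)
  \<comment> \<open>Disjointness makes \<open>S\<close> a Hahn set for \<open>\<mu>\<close>, which
    identifies the Jordan parts as \<open>P\<close> and \<open>Q\<close>.\<close>
  have S0: "emeasure P (- S) = 0" "emeasure Q S = 0" using disj by (auto simp: emP emQ)
  have pos: "jordan_pos \<mu> = P"
    unfolding \<mu>_def using fin S0 by (intro jordan_pos_diff[where S=S]) auto
  have neg: "jordan_neg \<mu> = Q"
    unfolding \<mu>_def using fin S0 by (intro jordan_neg_diff[where S=S]) auto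
  have "\<mu> \<in> neutral_charges (S \<union> T)"
    unfolding neutral_charges_def
  proof (intro CollectI conjI)
    show "signed_borel_measure \<mu>"
      unfolding \<mu>_def using fin by (intro signed_borel_measure_diff) auto
    have "A \<inter> S = {} \<and> A \<inter> T = {}" if "A \<inter> (S \<union> T) = {}" for A using that by blast
    thus "supported_on \<mu> (S \<union> T)"
      unfolding supported_on_def \<mu>_def by (auto simp: measure_def emP emQ)
    have "(S \<union> T) \<inter> S = S" "(S \<union> T) \<inter> T = T" by auto
    thus "\<mu> (S \<union> T) = 0" by (simp add: \<mu>_def measure_def emP emQ emS emT)
  qed
  hence "field_energy E (S \<union> T)
      \<le> I2 \<mu> - ereal (set_integral_signed \<mu> (S \<union> T) (\<lambda>x. E \<bullet> x))"
    unfolding field_energy_def by (rule INF_lower)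
  also have "\<dots> \<le> ereal (2 * (C * w)) - ereal (w * (p - q))"
  proof (rule ereal_minus_mono)
    have C: "0 \<le> C" by (simp add: C_def)
    have "mutual_energy P P \<le> ennreal (C * w)" "mutual_energy Q Q \<le> ennreal (C * w)"
      using self_energy_le[of R S] self_energy_le[of R T] dim R S(2) T(2) C w
      by (simp_all add: P_def Q_def emS emT ennreal_mult'' flip: C_def)
    hence "mutual_energy P P + mutual_energy Q Q \<le> ennreal (2 * (C * w))"
      using C w add_mono[of "mutual_energy P P" "ennreal (C * w)" "mutual_energy Q Q" "ennreal (C * w)"]
      by (simp only: mult_2 ennreal_plus mult_nonneg_nonneg)
    hence "enn2ereal (mutual_energy P P + mutual_energy Q Q) \<le> enn2ereal (ennreal (2 * (C * w)))"
      by (simp only: less_eq_ennreal.rep_eq)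
    also have "\<dots> = ereal (2 * (C * w))" using C w by simp
    finally show "I2 \<mu> \<le> ereal (2 * (C * w))"
      using I2_le_self_energies[of \<mu>] pos neg by (metis order_trans)
  next
    \<comment> \<open>Reduces the field integrals over \<open>S \<union> T\<close> against the
      charge densities to Lebesgue integrals over \<open>S\<close> and over
      \<open>T\<close>.\<close>
    have sub: "(LINT x:(S \<union> T)|density lborel (indicator K :: 'a \<Rightarrow> ennreal). E \<bullet> x) = (LINT x:K|lborel. E \<bullet> x)"
      if "K \<in> sets borel" "K \<subseteq> S \<union> T" for K
    proof -
      have [measurable]: "K \<in> sets borel" by fact
      have "density lborel (indicator K :: 'a \<Rightarrow> ennreal) = density lborel (\<lambda>x. ennreal (indicator K x))"
        by (intro density_cong) (auto split: split_indicator)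
      hence "(LINT x:(S \<union> T)|density lborel (indicator K :: 'a \<Rightarrow> ennreal). E \<bullet> x)
          = (LINT x|lborel. indicator K x *\<^sub>R (indicator (S \<union> T) x *\<^sub>R (E \<bullet> x)))"
        unfolding set_lebesgue_integral_def by (simp only:) (intro integral_density, auto)
      also have "\<dots> = (LINT x:K|lborel. E \<bullet> x)"
        unfolding set_lebesgue_integral_def using that(2)
        by (intro Bochner_Integration.integral_cong) (auto split: split_indicator)
      finally show ?thesis .
    qed
    have int: "set_integrable lborel K (\<lambda>x. E \<bullet> x)" if "compact K" for K
      unfolding set_integrable_def using that
      by (intro borel_integrable_compact continuous_intros) auto
    have cint: "set_integrable lborel K (\<lambda>x. c)" if "compact K" for K :: "'a set" and c :: real
      unfolding set_integrable_def using that
      by (intro borel_integrable_compact continuous_intros) auto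
    have "w * p = (LINT x:S|lborel. p)"
      using emS vol by (simp add: set_integral_const)
    also have "\<dots> \<le> (LINT x:S|lborel. E \<bullet> x)"
      using S(1) bS by (intro set_integral_mono int cint) auto
    finally have 1: "w * p \<le> (LINT x:S|lborel. E \<bullet> x)" .
    have "(LINT x:T|lborel. E \<bullet> x) \<le> (LINT x:T|lborel. q)"
      using T(1) bT by (intro set_integral_mono int cint) auto
    also have "\<dots> = w * q" using emT vol by (simp add: set_integral_const)
    finally have 2: "(LINT x:T|lborel. E \<bullet> x) \<le> w * q" .
    have "set_integral_signed \<mu> (S \<union> T) (\<lambda>x. E \<bullet> x)
        = (LINT x:S|lborel. E \<bullet> x) - (LINT x:T|lborel. E \<bullet> x)"
      unfolding set_integral_signed_def pos neg unfolding P_def Q_def by (simp add: sub)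
    thus "ereal (w * (p - q)) \<le> ereal (set_integral_signed \<mu> (S \<union> T) (\<lambda>x. E \<bullet> x))"
      using 1 2 by (simp add: algebra_simps)
  qed
  finally show ?thesis by (simp add: C_def)
qed

section \<open>Two congruent cubes pulled apart along the field\<close>

theorem theorem3p1:
  fixes E :: "real ^ 'n"
  assumes "CARD('n) \<ge> 3"
    and "E \<noteq> 0"
  shows "(INF \<Omega> \<in> {\<Omega> :: (real ^ 'n) set.
                     compact \<Omega> \<and> emeasure lebesgue \<Omega> = emeasure lebesgue (ball (0 :: real ^ 'n) 1)}.
            enn2ereal (hausdorff_measure (CARD('n) - 1) (frontier \<Omega>)) + field_energy E \<Omega>) = - \<infinity>"
proof (rule ereal_bot)
  fix B :: real
  let ?N = "CARD('n)"
  \<comment> \<open>Each cube takes half the volume of the unit ball; \<open>s\<close> is then its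
    side and \<open>R\<close> a bound for its diameter.\<close>
  define w where "w = measure lborel (ball (0 :: real ^ 'n) 1) / 2"
  have w: "w > 0" by (simp add: w_def content_ball)
  define s where "s = root ?N w"
  have s: "s > 0" using w by (simp add: s_def)
  have sN: "s ^ ?N = w" using w by (simp add: s_def)
  define R where "R = real ?N * s"
  have R: "R > 0" using s by (simp add: R_def)
  \<comment> \<open>\<open>H\<close> bounds the perimeter and \<open>C\<close> the sum of the
    self-energies; both are fixed before the translation is chosen.\<close>
  define H where "H = (4 * real ?N * 2 ^ (?N - 1)) * (unit_ball_vol (real (?N - 1)) * R ^ (?N - 1))"
  define C where "C = 2 * (2 ^ ?N * unit_ball_vol (real ?N) * R\<^sup>2 * w)"
  have nE: "norm E > 0" using assms(2) by simp
  \<comment> \<open>The first entry moves the cube by more than \<open>R\<close>, which makes the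
    two cubes disjoint. The second makes the field term outweigh \<open>H + C - B\<close>. Both
    divide by \<open>norm E\<close>, which is where \<open>E \<noteq> 0\<close> enters.\<close>
  define t where "t = max ((R + 1) / norm E) (((H + C - B) / w + 2 * norm E * R) / (norm E)\<^sup>2)"
  define v where "v = t *\<^sub>R E"
  have t1: "R + 1 \<le> t * norm E"
    using nE by (simp add: t_def pos_divide_le_eq[symmetric])
  have t0: "0 < t" using t1 R nE by (smt (verit) mult_nonpos_nonneg)
  have "(H + C - B) / w + 2 * norm E * R \<le> t * (norm E)\<^sup>2"
    using nE by (simp add: t_def pos_divide_le_eq[symmetric])
  hence "(H + C - B) / w \<le> t * (norm E)\<^sup>2 - 2 * norm E * R" by simp
  hence t2: "H + C - B \<le> w * (t * (norm E)\<^sup>2 - 2 * norm E * R)"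
    using w by (simp add: pos_divide_le_eq mult.commute)
  define T :: "(real ^ 'n) set" where "T = cbox 0 (0 + (\<chi> i. s))"
  define S where "S = cbox v (v + (\<chi> i. s))"
  have cube: "measure lborel (cbox a (a + (\<chi> i. s))) = w" for a :: "real ^ 'n"
  proof -
    have "cbox a (a + (\<chi> i. s)) \<noteq> {}" using s by (simp add: interval_ne_empty_cart)
    thus ?thesis using sN by (simp add: content_cbox_cart)
  qed
  have dT: "dist x y \<le> R" if "x \<in> T" "y \<in> T" for x y
    using that unfolding T_def R_def by (rule dist_le_cube)
  have dS: "dist x y \<le> R" if "x \<in> S" "y \<in> S" for x y
    using that unfolding S_def R_def by (rule dist_le_cube)
  have v_S: "v \<in> S" and z_T: "0 \<in> T" using s by (auto simp: S_def T_def mem_box_cart)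
  have shift: "x - v \<in> T" if "x \<in> S" for x
    using that by (auto simp: S_def T_def mem_box_cart algebra_simps)
  \<comment> \<open>A common point \<open>x\<close> would put both \<open>x\<close> and
    \<open>x - v\<close> into \<open>T\<close>, although their distance \<open>t * norm E\<close>
    exceeds \<open>R\<close>.\<close>
  have disj: "S \<inter> T = {}"
  proof (rule ccontr)
    assume "S \<inter> T \<noteq> {}"
    then obtain x where "x \<in> S" "x \<in> T" by blast
    hence "dist x (x - v) \<le> R" using dT shift by blast
    hence "t * norm E \<le> R" using t0 by (simp add: v_def dist_norm)
    thus False using t1 by simp
  qed
  have "\<bar>E \<bullet> x\<bar> \<le> norm E * R" if "x \<in> T" for x
  proof -
    have "norm x \<le> R" using dT[OF that z_T] by simp
    hence "norm E * norm x \<le> norm E * R" by (intro mult_left_mono) auto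
    thus ?thesis using Cauchy_Schwarz_ineq2[of E x] by simp
  qed
  hence bT: "E \<bullet> x \<le> norm E * R" "- (norm E * R) \<le> E \<bullet> x" if "x \<in> T" for x
    using that by (force simp: abs_le_iff)+
  \<comment> \<open>Translation by \<open>v = t *\<^sub>R E\<close> raises the potential
    \<open>E \<bullet> x\<close> by \<open>t * (norm E)\<^sup>2\<close>; the gap between the cubes
    is thus at least this minus \<open>2 * norm E * R\<close>.\<close>
  have bS: "t * (norm E)\<^sup>2 - norm E * R \<le> E \<bullet> x" if "x \<in> S" for x
    using bT(2)[OF shift[OF that]]
    by (simp add: v_def inner_diff_right power2_norm_eq_inner)
  define \<Omega> where "\<Omega> = S \<union> T"
  have comp: "compact S" "compact T" by (auto simp: S_def T_def)
  have vol: "measure lborel S = w" "measure lborel T = w" unfolding S_def T_def by (rule cube)+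
  have lm: "S \<in> lmeasurable" "T \<in> lmeasurable" using comp by (auto intro: lmeasurable_compact)
  \<comment> \<open>The volume constraint is stated for \<open>lebesgue\<close>, the energy estimate
    for \<open>lborel\<close>; the two agree on these Borel sets.\<close>
  have "measure lebesgue \<Omega> = measure lebesgue S + measure lebesgue T"
    unfolding \<Omega>_def using disj lm by (intro measure_Union) (auto simp: fmeasurable_def)
  also have "\<dots> = measure lborel S + measure lborel T"
    by (simp add: S_def T_def measure_completion)
  finally have "measure lebesgue \<Omega> = measure lborel S + measure lborel T" .
  hence "measure lebesgue \<Omega> = measure lebesgue (ball (0 :: real ^ 'n) 1)"
    using vol by (simp add: w_def measure_completion)
  hence "emeasure lebesgue \<Omega> = emeasure lebesgue (ball (0 :: real ^ 'n) 1)"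
    using lm by (simp only: \<Omega>_def emeasure_eq_measure2 fmeasurable.Un lmeasurable_ball)
  hence "(INF \<Omega> \<in> {\<Omega> :: (real ^ 'n) set.
                     compact \<Omega> \<and> emeasure lebesgue \<Omega> = emeasure lebesgue (ball (0 :: real ^ 'n) 1)}.
            enn2ereal (hausdorff_measure (?N - 1) (frontier \<Omega>)) + field_energy E \<Omega>)
    \<le> enn2ereal (hausdorff_measure (?N - 1) (frontier \<Omega>)) + field_energy E \<Omega>"
    using comp by (intro INF_lower) (auto simp: \<Omega>_def)
  also have "\<dots> \<le> ereal H + ereal (C - w * (t * (norm E)\<^sup>2 - norm E * R - norm E * R))"
  proof (rule add_mono)
    have "hausdorff_measure (?N - 1) (frontier \<Omega>) \<le> ennreal H"
      unfolding \<Omega>_def S_def T_def H_def R_def by (rule hausdorff_measure_two_cubes[OF s])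
    hence "enn2ereal (hausdorff_measure (?N - 1) (frontier \<Omega>)) \<le> enn2ereal (ennreal H)"
      by (simp only: less_eq_ennreal.rep_eq)
    moreover have "0 \<le> H" using R by (simp add: H_def)
    ultimately show "enn2ereal (hausdorff_measure (?N - 1) (frontier \<Omega>)) \<le> ereal H"
      by (simp add: enn2ereal_ennreal)
    show "field_energy E \<Omega> \<le> ereal (C - w * (t * (norm E)\<^sup>2 - norm E * R - norm E * R))"
      using field_energy_two_sets_le[OF _ R comp(1) dS comp(2) dT disj vol bS bT(1)] assms(1)
      by (simp add: \<Omega>_def C_def)
  qed
  also have "\<dots> \<le> ereal B" using t2 by (simp add: algebra_simps)
  finally show "(INF \<Omega> \<in> {\<Omega> :: (real ^ 'n) set.
                     compact \<Omega> \<and> emeasure lebesgue \<Omega> = emeasure lebesgue (ball (0 :: real ^ 'n) 1)}.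
            enn2ereal (hausdorff_measure (?N - 1) (frontier \<Omega>)) + field_energy E \<Omega>) \<le> ereal B" .
qed

end
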